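(* Let $(M,d)$ be a generalized metric space. Any (forward) alternative Cauchy sequence $\sigma$ in $M$ contains some subsequence $\sigma'$ which is a (forward) Cauchy sequence, and $\sigma\sim\sigma'$. Moreover, $\sigma$ converges if and only if so does $\sigma'$, and the natural projection $$(\mathrm{Cau}_{\mathrm{alt}}(M)/\sim)\to(\mathrm{Cau}(M)/\sim),\qquad[\sigma]\mapsto[\sigma'],$$ is well-defined and bijective.
   Context: A generalized metric space $(M,d)$ is a set with a map $d:M\times M\to\mathbb R$ such that: $d\ge0$; $d(x,y)=d(y,x)=0$ iff $x=y$; $d(x,z)\le d(x,y)+d(y,z)$; and for any sequence $\{x_n\}$ and $x\in M$, $d(x_n,x)\to0$ iff $d(x,x_n)\to0$. Its topology is generated by the forward open balls $\{y:d(x,y)<r\}$ (equivalently, by the backward ones $\{y:d(y,x)<r\}$), and $x_n\to x$ iff $d(x_n,x)\to0$. $\{x_n\}$ is a (forward) Cauchy sequence if for all $\epsilon>0$ there is $n_0$ with $d(x_n,x_m)<\epsilon$ whenever $n_0\le n\le m$; $\mathrm{Cau}(M)$ is the set of these. $\{x_n\}$ is a (forward) alternative Cauchy sequence if $\lim_n(\lim_md(x_n,x_m))=0$, in the sense that for all $\epsilon>0$ there is $n_0$ such that for all $n\ge n_0$ there is $m_0(n)$ with $d(x_n,x_m)<\epsilon$ for all $m\ge m_0(n)$; $\mathrm{Cau}_{\mathrm{alt}}(M)$ is the set of these. All double limits are understood in this sense. For sequences $\sigma=\{x_n\}$, $\sigma'=\{x'_n\}$, $\sigma\sim\sigma'$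 means $\lim_n(\lim_md(x_n,x'_m))=\lim_n(\lim_md(x'_n,x_m))=0$; this is an equivalence relation on $\mathrm{Cau}(M)$ and on $\mathrm{Cau}_{\mathrm{alt}}(M)$. *)

theory Defs
  imports "HOL-Analysis.Analysis"
begin

locale gen_metric_space =
  fixes M :: "'a set" and d :: "'a \<Rightarrow> 'a \<Rightarrow> real"
  assumes nonneg: "\<lbrakk>x \<in> M; y \<in> M\<rbrakk> \<Longrightarrow> 0 \<le> d x y"
    and zero_iff: "\<lbrakk>x \<in> M; y \<in> M\<rbrakk> \<Longrightarrow> (d x y = 0 \<and> d y x = 0) \<longleftrightarrow> x = y"
    and triangle: "\<lbrakk>x \<in> M; y \<in> M; z \<in> M\<rbrakk> \<Longrightarrow> d x z \<le> d x y + d y z"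
    and tendsto_swap: "\<lbrakk>range \<sigma> \<subseteq> M; x \<in> M\<rbrakk> \<Longrightarrow>
      ((\<lambda>n. d (\<sigma> n) x) \<longlonglongrightarrow> 0) \<longleftrightarrow> ((\<lambda>n. d x (\<sigma> n)) \<longlonglongrightarrow> 0)"

definition gm_topology :: "'a set \<Rightarrow> ('a \<Rightarrow> 'a \<Rightarrow> real) \<Rightarrow> 'a topology" where
  "gm_topology M d = topology_generated_by {{y \<in> M. d x y < r} |x r. x \<in> M \<and> 0 < r}"

definition gm_convergent :: "'a set \<Rightarrow> ('a \<Rightarrow> 'a \<Rightarrow> real) \<Rightarrow> (nat \<Rightarrow> 'a) \<Rightarrow> bool" where
  "gm_convergent M d \<sigma> \<longleftrightarrow> (\<exists>x. limitin (gm_topology M d) \<sigma> x sequentially)"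

text \<open>The double limit \<open>lim\<^sub>n (lim\<^sub>m d (\<sigma> n) (\<tau> m)) = 0\<close>.  The inner limit need not exist: the condition is read as
  \<open>\<forall>\<epsilon>>0. \<exists>n\<^sub>0. \<forall>n\<ge>n\<^sub>0. \<exists>m\<^sub>0. \<forall>m\<ge>m\<^sub>0. d (\<sigma> n) (\<tau> m) < \<epsilon>\<close>, where \<open>m\<^sub>0\<close> may depend on \<open>n\<close>.\<close>

definition double_lim_zero ::
  "('a \<Rightarrow> 'a \<Rightarrow> real) \<Rightarrow> (nat \<Rightarrow> 'a) \<Rightarrow> (nat \<Rightarrow> 'a) \<Rightarrow> bool" where
  "double_lim_zero d \<sigma> \<tau> \<longleftrightarrow>
     (\<forall>\<epsilon>>0. \<exists>n0. \<forall>n\<ge>n0. \<exists>m0. \<forall>m\<ge>m0. d (\<sigma> n) (\<tau> m) < \<epsilon>)"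

definition Cau :: "'a set \<Rightarrow> ('a \<Rightarrow> 'a \<Rightarrow> real) \<Rightarrow> (nat \<Rightarrow> 'a) set" where
  "Cau M d = {\<sigma>. range \<sigma> \<subseteq> M \<and>
     (\<forall>\<epsilon>>0. \<exists>n0. \<forall>n m. n0 \<le> n \<and> n \<le> m \<longrightarrow> d (\<sigma> n) (\<sigma> m) < \<epsilon>)}"

definition Cau_alt :: "'a set \<Rightarrow> ('a \<Rightarrow> 'a \<Rightarrow> real) \<Rightarrow> (nat \<Rightarrow> 'a) set" where
  "Cau_alt M d = {\<sigma>. range \<sigma> \<subseteq> M \<and> double_lim_zero d \<sigma> \<sigma>}"

definition seq_equiv ::
  "('a \<Rightarrow> 'a \<Rightarrow> real) \<Rightarrow> (nat \<Rightarrow> 'a) \<Rightarrow> (nat \<Rightarrow> 'a) \<Rightarrow> bool" where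
  "seq_equiv d \<sigma> \<tau> \<longleftrightarrow> double_lim_zero d \<sigma> \<tau> \<and> double_lim_zero d \<tau> \<sigma>"

definition seq_rel ::
  "('a \<Rightarrow> 'a \<Rightarrow> real) \<Rightarrow> (nat \<Rightarrow> 'a) set \<Rightarrow> ((nat \<Rightarrow> 'a) \<times> (nat \<Rightarrow> 'a)) set" where
  "seq_rel d S = {(\<sigma>, \<tau>). \<sigma> \<in> S \<and> \<tau> \<in> S \<and> seq_equiv d \<sigma> \<tau>}"

context gen_metric_space
begin

lemma dist_self: "x \<in> M \<Longrightarrow> d x x = 0"
  using zero_iff by blast

lemma Cau_subset_Cau_alt: "Cau M d \<subseteq> Cau_alt M d"
  unfolding Cau_def Cau_alt_def double_lim_zero_def by (auto; meson order_trans)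

lemma double_lim_zero_trans:
  assumes M: "range \<rho> \<subseteq> M" "range \<sigma> \<subseteq> M" "range \<tau> \<subseteq> M"
    and "double_lim_zero d \<rho> \<sigma>" "double_lim_zero d \<sigma> \<tau>"
  shows "double_lim_zero d \<rho> \<tau>"
  unfolding double_lim_zero_def
proof (intro allI impI)
  fix e :: real assume "0 < e"
  then have e: "0 < e / 2" by simp
  obtain n1 where n1: "\<And>n. n \<ge> n1 \<Longrightarrow> \<exists>k0. \<forall>k\<ge>k0. d (\<rho> n) (\<sigma> k) < e / 2"
    using assms(4) e unfolding double_lim_zero_def by blast
  obtain k1 where k1: "\<And>k. k \<ge> k1 \<Longrightarrow> \<exists>m0. \<forall>m\<ge>m0. d (\<sigma> k) (\<tau> m) < e / 2"
    using assms(5) e unfolding double_lim_zero_def by blast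
  have "\<exists>m0. \<forall>m\<ge>m0. d (\<rho> n) (\<tau> m) < e" if n: "n \<ge> n1" for n
  proof -
    obtain k0 where k0: "\<And>k. k \<ge> k0 \<Longrightarrow> d (\<rho> n) (\<sigma> k) < e / 2"
      using n1[OF n] by blast
    define k where "k = max k0 k1"
    have a: "d (\<rho> n) (\<sigma> k) < e / 2"
      by (rule k0) (simp add: k_def)
    obtain m0 where m0: "\<And>m. m \<ge> m0 \<Longrightarrow> d (\<sigma> k) (\<tau> m) < e / 2"
      using k1[of k] by (auto simp: k_def)
    have "d (\<rho> n) (\<tau> m) < e" if "m \<ge> m0" for m
    proof -
      have "d (\<rho> n) (\<tau> m) \<le> d (\<rho> n) (\<sigma> k) + d (\<sigma> k) (\<tau> m)"
        using M by (intro triangle) auto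
      then show ?thesis using a m0[OF that] by simp
    qed
    then show ?thesis by blast
  qed
  then show "\<exists>n0. \<forall>n\<ge>n0. \<exists>m0. \<forall>m\<ge>m0. d (\<rho> n) (\<tau> m) < e" by blast
qed

lemma equiv_seq_rel:
  assumes "S \<subseteq> Cau_alt M d"
  shows "equiv S (seq_rel d S)"
proof (rule equivI)
  show "seq_rel d S \<subseteq> S \<times> S"
    by (auto simp: seq_rel_def)
  show "refl_on S (seq_rel d S)"
    using assms by (auto simp: refl_on_def seq_rel_def seq_equiv_def Cau_alt_def)
  show "sym (seq_rel d S)"
    by (auto simp: sym_def seq_rel_def seq_equiv_def)
  have "range \<sigma> \<subseteq> M" if "\<sigma> \<in> S" for \<sigma>
    using assms that by (auto simp: Cau_alt_def)
  then show "trans (seq_rel d S)"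
    unfolding trans_def seq_rel_def seq_equiv_def
    by (auto intro: double_lim_zero_trans)
qed

lemma equiv_Cau_alt: "equiv (Cau_alt M d) (seq_rel d (Cau_alt M d))"
  and equiv_Cau: "equiv (Cau M d) (seq_rel d (Cau M d))"
  by (simp_all add: equiv_seq_rel Cau_subset_Cau_alt)

lemma topspace_gm_topology: "topspace (gm_topology M d) = M"
proof
  let ?B = "{{y \<in> M. d x y < r} |x r. x \<in> M \<and> 0 < r}"
  have eq: "topspace (gm_topology M d) = \<Union> ?B"
    unfolding gm_topology_def by (rule topology_generated_by_topspace)
  show "topspace (gm_topology M d) \<subseteq> M"
    unfolding eq by blast
  show "M \<subseteq> topspace (gm_topology M d)"
  proof
    fix x assume x: "x \<in> M"
    then have "{y \<in> M. d x y < 1} \<in> ?B"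
      unfolding mem_Collect_eq by (intro exI[of _ x] exI[of _ 1]) simp
    moreover have "x \<in> {y \<in> M. d x y < 1}"
      using x by (simp add: dist_self)
    ultimately show "x \<in> topspace (gm_topology M d)"
      unfolding eq by (rule UnionI)
  qed
qed

lemma forward_ball_in_open:
  assumes "openin (gm_topology M d) U" "x \<in> U"
  shows "\<exists>r>0. {y \<in> M. d x y < r} \<subseteq> U"
proof -
  have "generate_topology_on {{y \<in> M. d x y < r} |x r. x \<in> M \<and> 0 < r} U"
    using assms(1) by (simp add: gm_topology_def openin_topology_generated_by_iff)
  then have "\<forall>x\<in>U. \<exists>r>0. {y \<in> M. d x y < r} \<subseteq> U"
  proof induction
    case Empty
    then show ?case by simp
  next
    case (Int a b)
    show ?case
    proof
      fix x assume "x \<in> a \<inter> b"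
      then obtain r s where "r > 0" "{y \<in> M. d x y < r} \<subseteq> a" "s > 0" "{y \<in> M. d x y < s} \<subseteq> b"
        using Int by (meson IntD1 IntD2)
      then show "\<exists>r>0. {y \<in> M. d x y < r} \<subseteq> a \<inter> b"
        by (intro exI[of _ "min r s"]) auto
    qed
  next
    case (UN K)
    then show ?case by (meson Union_iff Sup_upper order_trans)
  next
    case (Basis s)
    then obtain c r where c: "c \<in> M" "0 < r" "s = {y \<in> M. d c y < r}" by blast
    show ?case
    proof
      fix x assume x: "x \<in> s"
      have "d c y < r" if "y \<in> M" "d x y < r - d c x" for y
        using triangle[of c x y] that c x by auto
      then show "\<exists>r>0. {y \<in> M. d x y < r} \<subseteq> s"
        using c x by (intro exI[of _ "r - d c x"]) auto
    qed
  qed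
  then show ?thesis using assms(2) by blast
qed

lemma limitin_gm_topology:
  assumes \<sigma>: "range \<sigma> \<subseteq> M"
  shows "limitin (gm_topology M d) \<sigma> x sequentially \<longleftrightarrow> x \<in> M \<and> (\<lambda>n. d (\<sigma> n) x) \<longlonglongrightarrow> 0"
proof (cases "x \<in> M")
  case True
  have in_M: "\<sigma> n \<in> M" for n using \<sigma> by blast
  have "limitin (gm_topology M d) \<sigma> x sequentially \<longleftrightarrow>
      (\<forall>r>0. \<forall>\<^sub>F n in sequentially. d x (\<sigma> n) < r)"
  proof
    assume L: "limitin (gm_topology M d) \<sigma> x sequentially"
    show "\<forall>r>0. \<forall>\<^sub>F n in sequentially. d x (\<sigma> n) < r"
    proof (intro allI impI)
      fix r :: real assume "0 < r"
      have "openin (gm_topology M d) {y \<in> M. d x y < r}"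
        unfolding gm_topology_def using True \<open>0 < r\<close>
        by (intro topology_generated_by_Basis) blast
      moreover have "x \<in> {y \<in> M. d x y < r}"
        using True \<open>0 < r\<close> by (simp add: dist_self)
      ultimately have "\<forall>\<^sub>F n in sequentially. \<sigma> n \<in> {y \<in> M. d x y < r}"
        using L unfolding limitin_def by blast
      then show "\<forall>\<^sub>F n in sequentially. d x (\<sigma> n) < r"
        by (rule eventually_mono) simp
    qed
  next
    assume R: "\<forall>r>0. \<forall>\<^sub>F n in sequentially. d x (\<sigma> n) < r"
    show "limitin (gm_topology M d) \<sigma> x sequentially"
      unfolding limitin_def topspace_gm_topology
    proof (intro conjI True allI impI)
      fix U assume "openin (gm_topology M d) U \<and> x \<in> U"
      then obtain r where r: "r > 0" "{y \<in> M. d x y < r} \<subseteq> U"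
        using forward_ball_in_open by blast
      show "\<forall>\<^sub>F n in sequentially. \<sigma> n \<in> U"
        using R[rule_format, OF r(1)] by (rule eventually_mono) (use r in_M in blast)
    qed
  qed
  also have "\<dots> \<longleftrightarrow> (\<lambda>n. d x (\<sigma> n)) \<longlonglongrightarrow> 0"
    using True in_M nonneg by (simp add: tendsto_iff dist_real_def)
  also have "\<dots> \<longleftrightarrow> (\<lambda>n. d (\<sigma> n) x) \<longlonglongrightarrow> 0"
    using tendsto_swap[OF \<sigma> True] by simp
  finally show ?thesis using True by simp
next
  case False
  then show ?thesis by (simp add: limitin_def topspace_gm_topology)
qed

end

end

theory Submission
  imports Defs
begin

text \<open>In an alternative Cauchy sequence, each late term is close to all sufficiently late ones, so a
  Cauchy subsequence can be picked greedily: the index chosen at each step lies beyond the threshold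
  of its predecessor and hence, by monotonicity, beyond those of all earlier terms.  Any subsequence
  is equivalent to the whole sequence, and equivalent sequences have the same limits by the triangle
  inequality.  The projection on classes is therefore \<open>C \<mapsto> C \<inter> Cau(M)\<close>: every class of alternative
  Cauchy sequences meets \<open>Cau(M)\<close>, in exactly one class.\<close>

text \<open>Since \<open>n \<le> r n\<close>, the outer threshold for \<open>\<sigma>\<close> also
  serves \<open>\<sigma> \<circ> r\<close>; in the right-hand version the same holds for the inner
  thresholds.\<close>

lemma double_lim_zero_subseq_left:
  assumes "double_lim_zero d \<sigma> \<tau>" "strict_mono r"
  shows "double_lim_zero d (\<sigma> \<circ> r) \<tau>"
  using assms unfolding double_lim_zero_def comp_def
  by (meson order_trans strict_mono_imp_increasing)

lemma double_lim_zero_subseq_right: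
  assumes "double_lim_zero d \<sigma> \<tau>" "strict_mono r"
  shows "double_lim_zero d \<sigma> (\<tau> \<circ> r)"
  using assms unfolding double_lim_zero_def comp_def
  by (meson order_trans strict_mono_imp_increasing)

lemma seq_equiv_subseq:
  assumes "\<sigma> \<in> Cau_alt M d" "strict_mono r"
  shows "seq_equiv d \<sigma> (\<sigma> \<circ> r)"
  using assms
  by (simp add: seq_equiv_def Cau_alt_def double_lim_zero_subseq_left double_lim_zero_subseq_right)

context gen_metric_space
begin

lemma Cau_alt_Cauchy_subseq:
  assumes "\<sigma> \<in> Cau_alt M d"
  obtains r :: "nat \<Rightarrow> nat" where "strict_mono r" "\<sigma> \<circ> r \<in> Cau M d"
proof -
  have ran: "range \<sigma> \<subseteq> M" and dl: "double_lim_zero d \<sigma> \<sigma>"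
    using assms by (auto simp: Cau_alt_def)
  \<comment> \<open>This is the invariant of the greedy choice: index \<open>n\<close> has a
    threshold at precision \<open>1 / Suc k\<close>. The threshold stays existential, as it is only
    used when the next index is picked.\<close>
  define P where "P k n \<longleftrightarrow> (\<exists>m0. \<forall>m\<ge>m0. d (\<sigma> n) (\<sigma> m) < 1 / Suc k)" for k n
  have ev: "\<exists>n0. \<forall>n\<ge>n0. P k n" for k
    using dl unfolding double_lim_zero_def P_def by simp
  have "\<exists>r. \<forall>k. P k (r k) \<and> (r k < r (Suc k) \<and> (\<forall>m\<ge>r (Suc k). d (\<sigma> (r k)) (\<sigma> m) < 1 / Suc k))"
  proof (rule dependent_nat_choice)
    show "\<exists>n. P 0 n" using ev by blast
  next
    fix n k assume "P k n"
    then obtain m0 where m0: "\<And>m. m \<ge> m0 \<Longrightarrow> d (\<sigma> n) (\<sigma> m) < 1 / Suc k"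
      unfolding P_def by blast
    obtain n0 where n0: "\<And>n. n \<ge> n0 \<Longrightarrow> P (Suc k) n"
      using ev by blast
    show "\<exists>y. P (Suc k) y \<and> n < y \<and> (\<forall>m\<ge>y. d (\<sigma> n) (\<sigma> m) < 1 / Suc k)"
      \<comment> \<open>\<open>Suc n\<close> makes the indices strictly increase, \<open>m0\<close>
        passes the threshold of \<open>\<sigma> n\<close>, and \<open>n0\<close> restores the
        invariant at the next precision.\<close>
      by (rule exI[of _ "max (Suc n) (max m0 n0)"]) (use n0 m0 in auto)
  qed
  then obtain r where r: "\<And>k. r k < r (Suc k)"
    and close: "\<And>k m. r (Suc k) \<le> m \<Longrightarrow> d (\<sigma> (r k)) (\<sigma> m) < 1 / Suc k"
    by blast
  have mono: "strict_mono r"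
    using r by (simp add: strict_mono_Suc_iff)
  have dist: "d (\<sigma> (r n)) (\<sigma> (r m)) < 1 / Suc n" if "n \<le> m" for n m
  \<comment> \<open>\<open>close\<close> only reaches indices from \<open>r (Suc n)\<close> on, so
    the diagonal is treated apart.\<close>
  proof (cases "n = m")
    case True
    moreover have "\<sigma> (r m) \<in> M" using ran by blast
    ultimately show ?thesis by (simp add: dist_self)
  next
    case False
    with that mono show ?thesis
      by (intro close) (simp add: strict_mono_less_eq)
  qed
  have "\<exists>n0. \<forall>n m. n0 \<le> n \<and> n \<le> m \<longrightarrow> d (\<sigma> (r n)) (\<sigma> (r m)) < e" if e: "0 < e" for e
  proof -
    obtain n0 where n0: "1 / Suc n0 < e"
      using nat_approx_posE[OF e] .
    have "d (\<sigma> (r n)) (\<sigma> (r m)) < e" if "n0 \<le> n" "n \<le> m" for n m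
    proof -
      have "1 / Suc n \<le> 1 / Suc n0"
        using that by (simp add: frac_le)
      then show ?thesis using dist[OF that(2)] n0 by linarith
    qed
    then show ?thesis by blast
  qed
  then have "\<sigma> \<circ> r \<in> Cau M d"
    using ran by (auto simp: Cau_def)
  with mono show ?thesis by (rule that)
qed

text \<open>Going from \<open>\<tau> n\<close> to \<open>x\<close> through a late
  \<open>\<sigma> m\<close> costs at most
  \<open>d (\<tau> n) (\<sigma> m) + d (\<sigma> m) x\<close>.\<close>

lemma double_lim_zero_tendsto:
  assumes ran: "range \<sigma> \<subseteq> M" "range \<tau> \<subseteq> M" and x: "x \<in> M"
    and dl: "double_lim_zero d \<tau> \<sigma>" and lim: "(\<lambda>n. d (\<sigma> n) x) \<longlonglongrightarrow> 0"
  shows "(\<lambda>n. d (\<tau> n) x) \<longlonglongrightarrow> 0"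
proof (rule LIMSEQ_I)
  fix e :: real assume "0 < e"
  then have e: "0 < e / 2" by simp
  obtain n0 where n0: "\<And>n. n \<ge> n0 \<Longrightarrow> \<exists>m0. \<forall>m\<ge>m0. d (\<tau> n) (\<sigma> m) < e / 2"
    using dl e unfolding double_lim_zero_def by blast
  obtain m1 where m1: "\<And>m. m \<ge> m1 \<Longrightarrow> norm (d (\<sigma> m) x - 0) < e / 2"
    using LIMSEQ_D[OF lim e] by blast
  have "norm (d (\<tau> n) x - 0) < e" if n: "n \<ge> n0" for n
  proof -
    obtain m0 where m0: "\<And>m. m \<ge> m0 \<Longrightarrow> d (\<tau> n) (\<sigma> m) < e / 2"
      using n0[OF n] by blast
    \<comment> \<open>The threshold \<open>m0\<close> depends on \<open>n\<close>, but this is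
      harmless: \<open>m\<close> does not occur in the distance \<open>d (\<tau> n) x\<close> being
      bounded.\<close>
    define m where "m = max m0 m1"
    have inM: "\<tau> n \<in> M" "\<sigma> m \<in> M" using ran by auto
    have "d (\<tau> n) (\<sigma> m) < e / 2" "norm (d (\<sigma> m) x - 0) < e / 2"
      using m0[of m] m1[of m] by (auto simp: m_def)
    then show ?thesis
      using triangle[OF inM x] nonneg[OF inM(1) x] by auto
  qed
  then show "\<exists>n0. \<forall>n\<ge>n0. norm (d (\<tau> n) x - 0) < e" by blast
qed

lemma seq_equiv_convergent_iff:
  assumes "range \<sigma> \<subseteq> M" "range \<tau> \<subseteq> M" "seq_equiv d \<sigma> \<tau>"
  shows "gm_convergent M d \<sigma> \<longleftrightarrow> gm_convergent M d \<tau>"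
  using assms double_lim_zero_tendsto unfolding gm_convergent_def seq_equiv_def
  by (metis limitin_gm_topology)

text \<open>This is the source of well-definedness: \<open>\<tau>\<close> is any equivalent Cauchy
  sequence, while the left-hand side involves no choice of \<open>\<tau>\<close>. Both sequences
  have the same class in \<open>Cau_alt M d\<close>, and \<open>seq_rel d (Cau M d)\<close> is the
  restriction of the relation there.\<close>

lemma seq_rel_class_Int_Cau:
  assumes "\<sigma> \<in> Cau_alt M d" "\<tau> \<in> Cau M d" "seq_equiv d \<sigma> \<tau>"
  shows "seq_rel d (Cau_alt M d) `` {\<sigma>} \<inter> Cau M d = seq_rel d (Cau M d) `` {\<tau>}"
proof -
  have "(\<sigma>, \<tau>) \<in> seq_rel d (Cau_alt M d)"
    using assms Cau_subset_Cau_alt by (auto simp: seq_rel_def)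
  then have "seq_rel d (Cau_alt M d) `` {\<sigma>} = seq_rel d (Cau_alt M d) `` {\<tau>}"
    by (rule equiv_class_eq[OF equiv_Cau_alt])
  then show ?thesis
    using assms(2) Cau_subset_Cau_alt by (auto simp: seq_rel_def)
qed

text \<open>For injectivity, two classes with the same trace on \<open>Cau M d\<close> share a
  Cauchy sequence, and classes that meet coincide. For surjectivity, the class of a Cauchy sequence
  is the trace of its class in \<open>Cau_alt M d\<close>.\<close>

lemma bij_betw_Int_Cau:
  "bij_betw (\<lambda>C. C \<inter> Cau M d) (Cau_alt M d // seq_rel d (Cau_alt M d)) (Cau M d // seq_rel d (Cau M d))"
proof (rule bij_betw_imageI)
  let ?R = "seq_rel d (Cau_alt M d)"
  have repr: "\<exists>\<tau> \<in> Cau M d. C = ?R `` {\<tau>} \<and> C \<inter> Cau M d = seq_rel d (Cau M d) `` {\<tau>}"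
    if C: "C \<in> Cau_alt M d // ?R" for C
  proof -
    obtain \<sigma> where \<sigma>: "\<sigma> \<in> Cau_alt M d" "C = ?R `` {\<sigma>}"
      using C by (rule quotientE)
    obtain r where r: "strict_mono r" "\<sigma> \<circ> r \<in> Cau M d"
      using Cau_alt_Cauchy_subseq[OF \<sigma>(1)] .
    have eq: "seq_equiv d \<sigma> (\<sigma> \<circ> r)"
      using \<sigma>(1) r(1) by (rule seq_equiv_subseq)
    have "(\<sigma>, \<sigma> \<circ> r) \<in> ?R"
      using \<sigma>(1) r(2) eq Cau_subset_Cau_alt by (auto simp: seq_rel_def)
    then have "C = ?R `` {\<sigma> \<circ> r}"
      unfolding \<sigma>(2) by (rule equiv_class_eq[OF equiv_Cau_alt])
    moreover have "C \<inter> Cau M d = seq_rel d (Cau M d) `` {\<sigma> \<circ> r}"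
      unfolding \<sigma>(2) using \<sigma>(1) r(2) eq by (rule seq_rel_class_Int_Cau)
    ultimately show ?thesis using r(2) by blast
  qed
  show "inj_on (\<lambda>C. C \<inter> Cau M d) (Cau_alt M d // ?R)"
  proof (rule inj_onI)
    fix C D assume C: "C \<in> Cau_alt M d // ?R" and D: "D \<in> Cau_alt M d // ?R"
      and eq: "C \<inter> Cau M d = D \<inter> Cau M d"
    obtain \<tau> where "\<tau> \<in> Cau M d" "C \<inter> Cau M d = seq_rel d (Cau M d) `` {\<tau>}"
      using repr[OF C] by blast
    \<comment> \<open>By reflexivity the trace contains \<open>\<tau>\<close>; equality of traces
      alone would say nothing if they were empty.\<close>
    then have "\<tau> \<in> C \<inter> Cau M d"
      using equiv_class_self[OF equiv_Cau] by blast
    then have "\<tau> \<in> C \<inter> D" using eq by blast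
    then show "C = D"
      using quotient_disj[OF equiv_Cau_alt C D] by blast
  qed
  show "(\<lambda>C. C \<inter> Cau M d) ` (Cau_alt M d // ?R) = Cau M d // seq_rel d (Cau M d)"
  proof (intro equalityI subsetI)
    fix D assume "D \<in> (\<lambda>C. C \<inter> Cau M d) ` (Cau_alt M d // ?R)"
    then show "D \<in> Cau M d // seq_rel d (Cau M d)"
      by (auto dest!: repr intro: quotientI)
  next
    fix D assume "D \<in> Cau M d // seq_rel d (Cau M d)"
    then obtain \<tau> where \<tau>: "\<tau> \<in> Cau M d" "D = seq_rel d (Cau M d) `` {\<tau>}"
      by (rule quotientE)
    have alt: "\<tau> \<in> Cau_alt M d"
      using \<tau>(1) Cau_subset_Cau_alt by blast
    then have "seq_equiv d \<tau> \<tau>"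
      by (simp add: Cau_alt_def seq_equiv_def)
    then have "D = ?R `` {\<tau>} \<inter> Cau M d"
      using \<tau> alt seq_rel_class_Int_Cau by simp
    then show "D \<in> (\<lambda>C. C \<inter> Cau M d) ` (Cau_alt M d // ?R)"
      using alt by (blast intro: quotientI)
  qed
qed

end

theorem theorem3p17:
  fixes M :: "'a set" and d :: "'a \<Rightarrow> 'a \<Rightarrow> real"
  assumes "gen_metric_space M d"
  shows "(\<forall>\<sigma> \<in> Cau_alt M d.
            (\<exists>r::nat \<Rightarrow> nat. strict_mono r \<and> \<sigma> \<circ> r \<in> Cau M d) \<and>
            (\<forall>r::nat \<Rightarrow> nat. strict_mono r \<and> \<sigma> \<circ> r \<in> Cau M d \<longrightarrow>
               seq_equiv d \<sigma> (\<sigma> \<circ> r) \<and>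
               (gm_convergent M d \<sigma> \<longleftrightarrow> gm_convergent M d (\<sigma> \<circ> r)))) \<and>
         (\<exists>f :: (nat \<Rightarrow> 'a) set \<Rightarrow> (nat \<Rightarrow> 'a) set.
            (\<forall>\<sigma> \<in> Cau_alt M d. \<forall>r::nat \<Rightarrow> nat. strict_mono r \<and> \<sigma> \<circ> r \<in> Cau M d \<longrightarrow>
               f (seq_rel d (Cau_alt M d) `` {\<sigma>}) = seq_rel d (Cau M d) `` {\<sigma> \<circ> r}) \<and>
            bij_betw f (Cau_alt M d // seq_rel d (Cau_alt M d)) (Cau M d // seq_rel d (Cau M d)))"
proof (intro conjI ballI)
  interpret gen_metric_space M d by fact
  fix \<sigma> assume \<sigma>: "\<sigma> \<in> Cau_alt M d"
  show "\<exists>r::nat \<Rightarrow> nat. strict_mono r \<and> \<sigma> \<circ> r \<in> Cau M d"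
    using Cau_alt_Cauchy_subseq[OF \<sigma>] by blast
  have "seq_equiv d \<sigma> (\<sigma> \<circ> r) \<and> (gm_convergent M d \<sigma> \<longleftrightarrow> gm_convergent M d (\<sigma> \<circ> r))"
    if "strict_mono r" for r :: "nat \<Rightarrow> nat"
  proof -
    have "range \<sigma> \<subseteq> M" using \<sigma> by (simp add: Cau_alt_def)
    moreover from this have "range (\<sigma> \<circ> r) \<subseteq> M" by auto
    ultimately show ?thesis
      using seq_equiv_subseq[OF \<sigma> that] seq_equiv_convergent_iff by blast
  qed
  then show "\<forall>r::nat \<Rightarrow> nat. strict_mono r \<and> \<sigma> \<circ> r \<in> Cau M d \<longrightarrow>
      seq_equiv d \<sigma> (\<sigma> \<circ> r) \<and> (gm_convergent M d \<sigma> \<longleftrightarrow> gm_convergent M d (\<sigma> \<circ> r))"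
    by blast
next
  interpret gen_metric_space M d by fact
  \<comment> \<open>Well-definedness is the equation for \<open>f\<close> over all representatives
    \<open>\<sigma>\<close> and all Cauchy subsequences; it follows from
    \<open>seq_rel_class_Int_Cau\<close> with \<open>\<tau> = \<sigma> \<circ> r\<close>.\<close>
  show "\<exists>f :: (nat \<Rightarrow> 'a) set \<Rightarrow> (nat \<Rightarrow> 'a) set.
      (\<forall>\<sigma> \<in> Cau_alt M d. \<forall>r::nat \<Rightarrow> nat. strict_mono r \<and> \<sigma> \<circ> r \<in> Cau M d \<longrightarrow>
         f (seq_rel d (Cau_alt M d) `` {\<sigma>}) = seq_rel d (Cau M d) `` {\<sigma> \<circ> r}) \<and>
      bij_betw f (Cau_alt M d // seq_rel d (Cau_alt M d)) (Cau M d // seq_rel d (Cau M d))"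
    using bij_betw_Int_Cau seq_rel_class_Int_Cau seq_equiv_subseq
    by (intro exI[of _ "\<lambda>C. C \<inter> Cau M d"]) blast
qed

end
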